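(* Let $1\le K\le N$, let $\mathcal{A}_1,\dots,\mathcal{A}_N$ be finite nonempty input sets all of the same cardinality $|\mathcal{A}_i|=|\mathcal{A}|$, let $\bm{\mathcal{A}}=\mathcal{A}_1\times\cdots\times\mathcal{A}_N$, and let $\mathcal{B}$ be a finite nonempty output set. Then $$\dim\mathcal{C}_{N,K}(\bm{\mathcal{A}};\mathcal{B})=(|\mathcal{B}|-1)\sum_{k=0}^K(|\mathcal{A}|-1)^k\binom{N}{k}.$$
   Context: A multiple access channel (MAC) $\bm{\mathcal{A}}\to\mathcal{B}$ is a family of conditional probabilities $p(b|a_1\cdots a_N)\ge0$ with $\sum_{b\in\mathcal{B}} p(b|a_1\cdots a_N)=1$; it is viewed as a vector in $\mathbb{R}^{|\mathcal{B}|\prod_i|\mathcal{A}_i|}$. $(N,K)$-local classical MACs: let $0,\mathbf{e}_1,\dots,\mathbf{e}_N$ be distinct symbols and for $S\subseteq\{1,\dots,N\}$ let $\mathcal{M}_S=\{0\}\cup\{\mathbf{e}_s:s\in S\}$. $\mathcal{C}_{N,K}(\bm{\mathcal{A}};\mathcal{B})$ is the set of MACs of the form $$p(b|a_1\cdots a_N)=\sum_{S:\,|S|=K}p_S\sum_{m\in\mathcal{M}_S}d(b|m)\,q_S(m|(a_s)_{s\in S}),$$ where $S$ ranges over subsets of $\{1,\dots,N\}$ of size $K$, $(p_S)$ is a probability distribution, each $q_S$ is a stochastic map $\prod_{s\in S}\mathcal{A}_s\to\mathcal{M}_S$, and $d$ is a stochastic map $\{0,\mathbf{e}_1,\dots,\mathbf{e}_N\}\to\mathcal{B}$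 (the same for all $S$). The dimension of a (not necessarily convex) set of points in $\mathbb{R}^n$ is the dimension of its affine hull. *)

theory Defs
  imports "HOL-Analysis.Analysis"
begin

definition prob_dist :: "'x set \<Rightarrow> ('x \<Rightarrow> real) \<Rightarrow> bool" where
  "prob_dist X w \<longleftrightarrow> (\<forall>x\<in>X. 0 \<le> w x) \<and> (\<Sum>x\<in>X. w x) = 1"

text \<open>A conditional distribution \<open>w y x\<close> stands for \<open>w(y|x)\<close>; it is constrained only for
  \<open>x \<in> X\<close> and \<open>y \<in> Y\<close>.\<close>

definition stochastic_map :: "'x set \<Rightarrow> 'y set \<Rightarrow> ('y \<Rightarrow> 'x \<Rightarrow> real) \<Rightarrow> bool" where
  "stochastic_map X Y w \<longleftrightarrow> (\<forall>x\<in>X. prob_dist Y (\<lambda>y. w y x))"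

text \<open>The senders are the elements of \<open>'n\<close>, so that \<open>N = CARD('n)\<close>, and the output set is the
  type \<open>'b\<close>. The input sets \<open>A i\<close> may differ from one another, so they are
  subsets of a common finite type \<open>'a\<close>. The space of real vectors indexed by outputs and tuples in
  the product of the \<open>A i\<close> is identified with the coordinate subspace of vectors in
  \<open>real ^ ('b \<times> ('n \<Rightarrow> 'a))\<close> vanishing at all tuples outside that product; this does not
  affect dimensions of affine hulls.\<close>

definition macs :: "('n::finite \<Rightarrow> 'a::finite set) \<Rightarrow> (real ^ ('b::finite \<times> ('n \<Rightarrow> 'a))) set" where
  "macs A = {p. stochastic_map (\<Pi>\<^sub>E i\<in>UNIV. A i) UNIV (\<lambda>b a. p $ (b, a)) \<and>
                (\<forall>b a. a \<notin> (\<Pi>\<^sub>E i\<in>UNIV. A i) \<longrightarrow> p $ (b, a) = 0)}"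

text \<open>Messages: \<open>None\<close> is the symbol \<open>0\<close> and \<open>Some s\<close> is the symbol \<open>e\<^sub>s\<close>.\<close>

definition messages :: "'n set \<Rightarrow> 'n option set" where
  "messages S = insert None (Some ` S)"

text \<open>The restricted tuple \<open>restrict a S\<close> is \<open>(a\<^sub>s)\<^bsub>s\<in>S\<^esub>\<close>, an element of the product of the
  \<open>A s\<close> over \<open>S\<close>. The decoder \<open>d\<close> is quantified once and hence shared by all \<open>S\<close>.\<close>

definition local_macs ::
    "nat \<Rightarrow> ('n::finite \<Rightarrow> 'a::finite set) \<Rightarrow> (real ^ ('b::finite \<times> ('n \<Rightarrow> 'a))) set" where
  "local_macs K A = {p \<in> macs A. \<exists>w q d.
      prob_dist {S. card S = K} w \<and>
      (\<forall>S. card S = K \<longrightarrow> stochastic_map (\<Pi>\<^sub>E s\<in>S. A s) (messages S) (q S)) \<and>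
      stochastic_map (messages UNIV) UNIV d \<and>
      (\<forall>b. \<forall>a \<in> (\<Pi>\<^sub>E i\<in>UNIV. A i).
         p $ (b, a) = (\<Sum>S | card S = K. w S * (\<Sum>m\<in>messages S. d b m * q S m (restrict a S))))}"

end

theory Submission imports Defs begin

text \<open>Fix an output \<open>b0\<close> and a reference input \<open>z\<close>, and let \<open>p0\<close> be the MAC with constant output
  \<open>b0\<close>. For \<open>b \<noteq> b0\<close> and an input \<open>a\<close> that differs from \<open>z\<close> on a set \<open>T\<close> of at most \<open>K\<close> senders, the
  MAC that outputs \<open>b\<close> if the input agrees with \<open>a\<close> on \<open>T\<close>, and \<open>b0\<close> otherwise, is local: a single set
  \<open>S \<supseteq> T\<close> suffices. The differences of these MACs with \<open>p0\<close> are linearly independent, by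
  triangularity with respect to \<open>card T\<close>. They also span all differences with \<open>p0\<close>, because the
  indicator of \<open>x\<^sub>s = z\<^sub>s\<close> is one minus the sum of the indicators of \<open>x\<^sub>s = v\<close> over \<open>v \<noteq> z\<^sub>s\<close>. Hence the
  dimension is the number of pairs \<open>(b, a)\<close>.\<close>

section \<open>Cylinders and the candidate basis vectors\<close>

definition support :: "('n \<Rightarrow> 'a) \<Rightarrow> ('n \<Rightarrow> 'a) \<Rightarrow> 'n set" where
  "support z a = {i. a i \<noteq> z i}"

text \<open>Keeping \<open>y\<close> total lets a pinned value be changed by a function update; the
  values of \<open>y\<close> outside \<open>S\<close> do not affect the set.\<close>

definition cylinder :: "('n \<Rightarrow> 'a set) \<Rightarrow> 'n set \<Rightarrow> ('n \<Rightarrow> 'a) \<Rightarrow> ('n \<Rightarrow> 'a) set" where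
  "cylinder A S y = {x \<in> \<Pi>\<^sub>E i\<in>UNIV. A i. \<forall>s\<in>S. x s = y s}"

text \<open>The tensor product \<open>(e\<^sub>b - e\<^sub>b\<^sub>0) \<otimes> g\<close>.\<close>

definition transfer :: "'b::finite \<Rightarrow> 'b \<Rightarrow> ('x::finite \<Rightarrow> real) \<Rightarrow> real ^ ('b \<times> 'x)" where
  "transfer b0 b g = (\<chi> j. (of_bool (fst j = b) - of_bool (fst j = b0)) * g (snd j))"

definition const_mac :: "('n::finite \<Rightarrow> 'a::finite set) \<Rightarrow> 'b::finite \<Rightarrow> real ^ ('b \<times> ('n \<Rightarrow> 'a))" where
  "const_mac A b0 = (\<chi> j. of_bool (fst j = b0 \<and> snd j \<in> (\<Pi>\<^sub>E i\<in>UNIV. A i)))"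

lemma transfer_nth: "transfer b0 b g $ (b', x) = (of_bool (b' = b) - of_bool (b' = b0)) * g x"
  by (simp add: transfer_def)

lemma transfer_self: "transfer b b g = 0"
  by (simp add: transfer_def vec_eq_iff)

lemma transfer_diff: "transfer b0 b (\<lambda>x. f x - g x) = transfer b0 b f - transfer b0 b g"
  by (simp add: transfer_def vec_eq_iff algebra_simps)

lemma transfer_scale: "transfer b0 b (\<lambda>x. r * f x) = r *\<^sub>R transfer b0 b f"
  by (simp add: transfer_def vec_eq_iff algebra_simps)

lemma transfer_sum: "transfer b0 b (\<lambda>x. \<Sum>i\<in>I. f i x) = (\<Sum>i\<in>I. transfer b0 b (f i))"
  by (simp add: transfer_def vec_eq_iff sum_distrib_left)

section \<open>Spanning by cylinders pinned away from the reference input\<close>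

lemma cylinder_remove:
  fixes A :: "'n::finite \<Rightarrow> 'a::finite set"
  assumes "s \<in> S" "y s = v" "v \<in> A s"
  shows "(indicator (cylinder A S y) :: _ \<Rightarrow> real) =
    (\<lambda>x. indicator (cylinder A (S - {s}) y) x -
       (\<Sum>u\<in>A s - {v}. indicator (cylinder A S (y(s := u))) x))"
proof
  fix x :: "'n \<Rightarrow> 'a"
  have *: "indicator (cylinder A S (y(s := u))) x =
      (if u = x s then indicator (cylinder A (S - {s}) y) x else (0::real))" for u
    using assms(1) by (auto simp: cylinder_def indicator_def)
  have "(\<Sum>u\<in>A s - {v}. indicator (cylinder A S (y(s := u))) x) =
      (if x s \<in> A s - {v} then indicator (cylinder A (S - {s}) y) x else (0::real))"
    unfolding * by simp
  then show "(indicator (cylinder A S y) x :: real) = indicator (cylinder A (S - {s}) y) x -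
       (\<Sum>u\<in>A s - {v}. indicator (cylinder A S (y(s := u))) x)"
    using assms by (auto simp: cylinder_def indicator_def PiE_iff)
qed

text \<open>Induction on the number of coordinates in \<open>S\<close> pinned to their reference
  value. Unpinning one of them, or repinning it to another value, lowers this number and never
  enlarges \<open>S\<close>. Once there are none left, \<open>S\<close> is the support of the input
  equal to \<open>y\<close> on \<open>S\<close> and to \<open>z\<close> elsewhere.\<close>

lemma transfer_cylinder_in_span:
  fixes A :: "'n::finite \<Rightarrow> 'a::finite set"
  assumes z: "z \<in> (\<Pi>\<^sub>E i\<in>UNIV. A i)"
    and "\<And>s. s \<in> S \<Longrightarrow> y s \<in> A s" and "card S \<le> K"
  shows "transfer b0 b (indicator (cylinder A S y)) \<in>
    span ((\<lambda>a. transfer b0 b (indicator (cylinder A (support z a) a))) `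
      {a \<in> \<Pi>\<^sub>E i\<in>UNIV. A i. card (support z a) \<le> K})"
  using assms(2,3)
proof (induction "card {s \<in> S. y s = z s}" arbitrary: S y rule: less_induct)
  case less
  let ?V = "(\<lambda>a. transfer b0 b (indicator (cylinder A (support z a) a))) `
      {a \<in> \<Pi>\<^sub>E i\<in>UNIV. A i. card (support z a) \<le> K}"
  show ?case
  proof (cases "{s \<in> S. y s = z s} = {}")
    case True
    define a where "a = (\<lambda>s. if s \<in> S then y s else z s)"
    have "support z a = S" using True by (auto simp: support_def a_def)
    moreover have "cylinder A S y = cylinder A S a" by (auto simp: cylinder_def a_def)
    moreover have "a \<in> (\<Pi>\<^sub>E i\<in>UNIV. A i)" using z less.prems by (auto simp: a_def PiE_iff)
    ultimately show ?thesis using less.prems by (auto intro!: span_base)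
  next
    case False
    then obtain s where s: "s \<in> S" "y s = z s" by auto
    have zs: "z s \<in> A s" using z by (simp add: PiE_iff)
    have 1: "transfer b0 b (indicator (cylinder A (S - {s}) y)) \<in> span ?V"
    proof (rule less.hyps)
      show "card {t \<in> S - {s}. y t = z t} < card {s \<in> S. y s = z s}"
        using s by (intro psubset_card_mono) auto
      show "card (S - {s}) \<le> K" using less.prems(2) by (meson card_Diff1_le le_trans finite)
    qed (use less.prems in auto)
    have 2: "transfer b0 b (indicator (cylinder A S (y(s := u)))) \<in> span ?V"
      if "u \<in> A s - {z s}" for u
    proof (rule less.hyps)
      show "card {t \<in> S. (y(s := u)) t = z t} < card {s \<in> S. y s = z s}"
        using s that by (intro psubset_card_mono) auto
    qed (use less.prems that in auto)
    show ?thesis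
      unfolding cylinder_remove[of s S y "z s" A, OF s zs] transfer_diff transfer_sum
      by (intro span_diff span_sum 1 2)
  qed
qed

text \<open>A function of the coordinates in \<open>S\<close> is a linear combination of cylinder
  indicators, one for each assignment on \<open>S\<close>.\<close>

lemma transfer_restrict_in_span:
  fixes A :: "'n::finite \<Rightarrow> 'a::finite set"
  assumes z: "z \<in> (\<Pi>\<^sub>E i\<in>UNIV. A i)" and S: "card S \<le> K"
  shows "transfer b0 b (\<lambda>x. indicator (\<Pi>\<^sub>E i\<in>UNIV. A i) x * h (restrict x S)) \<in>
    span ((\<lambda>a. transfer b0 b (indicator (cylinder A (support z a) a))) `
      {a \<in> \<Pi>\<^sub>E i\<in>UNIV. A i. card (support z a) \<le> K})"
proof -
  have *: "indicator (\<Pi>\<^sub>E i\<in>UNIV. A i) x * h (restrict x S) =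
      (\<Sum>y\<in>(\<Pi>\<^sub>E s\<in>S. A s). h y * indicator (cylinder A S y) x)" for x :: "'n \<Rightarrow> 'a"
  proof -
    have "h y * indicator (cylinder A S y) x =
        (if y = restrict x S then indicator (\<Pi>\<^sub>E i\<in>UNIV. A i) x * h (restrict x S) else 0)"
      if "y \<in> (\<Pi>\<^sub>E s\<in>S. A s)" for y
    proof -
      have "y = restrict x S \<longleftrightarrow> (\<forall>s\<in>S. x s = y s)"
        using that by (auto simp: fun_eq_iff PiE_iff extensional_def)
      then show ?thesis by (cases "y = restrict x S") (simp_all add: cylinder_def indicator_def)
    qed
    then have "(\<Sum>y\<in>(\<Pi>\<^sub>E s\<in>S. A s). h y * indicator (cylinder A S y) x) =
        (\<Sum>y\<in>(\<Pi>\<^sub>E s\<in>S. A s).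
          if y = restrict x S then indicator (\<Pi>\<^sub>E i\<in>UNIV. A i) x * h (restrict x S) else 0)"
      by (rule sum.cong[OF refl])
    also have "\<dots> = indicator (\<Pi>\<^sub>E i\<in>UNIV. A i) x * h (restrict x S)"
      by (auto simp: indicator_def PiE_iff)
    finally show ?thesis by simp
  qed
  show ?thesis
    unfolding * transfer_sum transfer_scale
    using assms by (intro span_sum span_scale transfer_cylinder_in_span) (auto simp: PiE_iff)
qed

text \<open>Normalisation determines the entry at \<open>b0\<close>: on an admissible input, its
  excess over 1 is minus the sum of the other entries. Outside the product both sides
  vanish.\<close>

lemma mac_minus_const_mac:
  assumes "p \<in> macs A"
  shows "p - const_mac A b0 = (\<Sum>b\<in>UNIV - {b0}. transfer b0 b (\<lambda>x. p $ (b, x)))"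
proof -
  have "(p - const_mac A b0) $ (b, x) =
      (\<Sum>b'\<in>UNIV - {b0}. transfer b0 b' (\<lambda>x. p $ (b', x))) $ (b, x)" for b x
  proof (cases "b = b0")
    case True
    have "(\<Sum>b\<in>UNIV. p $ (b, x)) = of_bool (x \<in> (\<Pi>\<^sub>E i\<in>UNIV. A i))"
      using assms by (auto simp: macs_def stochastic_map_def prob_dist_def)
    moreover have "(\<Sum>b'\<in>UNIV - {b0}. (of_bool (b0 = b') - 1) * p $ (b', x)) =
        - (\<Sum>b'\<in>UNIV - {b0}. p $ (b', x))"
      unfolding sum_negf[symmetric] by (rule sum.cong) auto
    ultimately show ?thesis using True
      by (simp add: transfer_nth const_mac_def sum.remove[of UNIV b0])
  next
    case False
    have "(\<Sum>b'\<in>UNIV - {b0}. of_bool (b = b') * p $ (b', x)) = p $ (b, x)"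
      using False by (simp add: of_bool_def if_distrib[of "\<lambda>r. r * _"] cong: if_cong)
    then show ?thesis using False by (simp add: transfer_nth const_mac_def)
  qed
  then show ?thesis by (simp add: vec_eq_iff)
qed

lemma local_mac_minus_const_mac_in_span:
  fixes A :: "'n::finite \<Rightarrow> 'a::finite set" and p :: "real ^ ('b::finite \<times> ('n \<Rightarrow> 'a))"
  assumes p: "p \<in> local_macs K A" and z: "z \<in> (\<Pi>\<^sub>E i\<in>UNIV. A i)"
  shows "p - const_mac A b0 \<in>
    span ((\<lambda>(b, a). transfer b0 b (indicator (cylinder A (support z a) a))) `
      ((UNIV - {b0}) \<times> {a \<in> \<Pi>\<^sub>E i\<in>UNIV. A i. card (support z a) \<le> K}))" (is "_ \<in> span ?V")
proof -
  obtain w q d where pm: "p \<in> macs A"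
    and eq: "\<And>b a. a \<in> (\<Pi>\<^sub>E i\<in>UNIV. A i) \<Longrightarrow>
      p $ (b, a) = (\<Sum>S | card S = K. w S * (\<Sum>m\<in>messages S. d b m * q S m (restrict a S)))"
    using p unfolding local_macs_def by blast
  have "transfer b0 b (\<lambda>x. p $ (b, x)) \<in> span ?V" if "b \<in> UNIV - {b0}" for b
  proof -
    \<comment> \<open>The indicator makes the formula valid at every \<open>x\<close>. Each summand
      depends on an admissible input only through its restriction to one set of size
      \<open>K\<close>.\<close>
    have *: "p $ (b, x) = (\<Sum>S | card S = K. indicator (\<Pi>\<^sub>E i\<in>UNIV. A i) x *
        (w S * (\<Sum>m\<in>messages S. d b m * q S m (restrict x S))))" for x
      using pm eq[of x b] by (cases "x \<in> (\<Pi>\<^sub>E i\<in>UNIV. A i)") (auto simp: macs_def)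
    have "transfer b0 b (\<lambda>x. p $ (b, x)) \<in>
        span ((\<lambda>a. transfer b0 b (indicator (cylinder A (support z a) a))) `
          {a \<in> \<Pi>\<^sub>E i\<in>UNIV. A i. card (support z a) \<le> K})"
      unfolding * transfer_sum
      by (intro span_sum
          transfer_restrict_in_span[OF z, where h = "\<lambda>y. w _ * (\<Sum>m\<in>messages _. d b m * q _ m y)"])
        simp
    also have "\<dots> \<subseteq> span ?V" using that by (intro span_mono) auto
    finally show ?thesis .
  qed
  then show ?thesis unfolding mac_minus_const_mac[OF pm] by (intro span_sum)
qed

section \<open>Realising the candidate basis vectors by local MACs\<close>

lemma const_mac_plus_transfer_in_local_macs:
  fixes A :: "'n::finite \<Rightarrow> 'a::finite set" and b :: "'b::finite"
  assumes K: "1 \<le> K" "K \<le> CARD('n)" and T: "card T \<le> K"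
  shows "const_mac A b0 + transfer b0 b (indicator (cylinder A T y)) \<in> local_macs K A"
    (is "?p \<in> _")
proof -
  obtain S where S: "T \<subseteq> S" "card S = K"
    using exists_subset_between[of T K "UNIV :: 'n set"] T K by auto
  \<comment> \<open>Since \<open>1 \<le> K\<close>, the set \<open>S\<close> is nonempty, so besides
    \<open>None\<close> there is a second message, which signals that the input agrees with
    \<open>y\<close> on \<open>T\<close>.\<close>
  then obtain s where s: "s \<in> S" using K by fastforce
  define out where "out = (\<lambda>x. if \<forall>t\<in>T. x t = y t then b else b0)"
  \<comment> \<open>The other sets of size \<open>K\<close> get weight 0 but still require a
    stochastic map; they always send \<open>None\<close>.\<close>
  define msg where "msg = (\<lambda>S' x. if S' = S \<and> (\<forall>t\<in>T. x t = y t) then Some s else None)"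
  define dec where "dec = (\<lambda>m :: 'n option. if m = None then b0 else b)"
  have p: "?p $ (b', x) = of_bool (b' = out x)" if "x \<in> (\<Pi>\<^sub>E i\<in>UNIV. A i)" for b' x
    using that by (auto simp: transfer_nth const_mac_def cylinder_def out_def indicator_def)
  have p0: "?p $ (b', x) = 0" if "x \<notin> (\<Pi>\<^sub>E i\<in>UNIV. A i)" for b' x
    using that by (auto simp: transfer_nth const_mac_def cylinder_def indicator_def)
  have pm: "?p \<in> macs A"
    using p p0 by (simp add: macs_def stochastic_map_def prob_dist_def)
  have msg: "msg S' x \<in> messages S'" for S' x using s by (auto simp: msg_def messages_def)
  have dec_msg: "dec (msg S (restrict x S)) = out x" for x
    using S(1) by (auto simp: dec_def msg_def out_def subset_iff)
  have "?p $ (b', x) = (\<Sum>S' | card S' = K. of_bool (S' = S) *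
      (\<Sum>m\<in>messages S'. of_bool (b' = dec m) * of_bool (m = msg S' (restrict x S'))))"
    if "x \<in> (\<Pi>\<^sub>E i\<in>UNIV. A i)" for b' x
  proof -
    have "(\<Sum>m\<in>messages S'. of_bool (b' = dec m) * of_bool (m = msg S' (restrict x S'))) =
        (of_bool (b' = dec (msg S' (restrict x S'))) :: real)" for S'
      using msg[of S' "restrict x S'"]
      by (simp add: of_bool_def if_distrib[of "\<lambda>r. _ * r"] messages_def cong: if_cong)
    then show ?thesis
      using S(2) dec_msg[of x]
      unfolding p[OF that] by (simp add: of_bool_def[of "_ = S"] if_distrib[of "\<lambda>r. r * _"] cong: if_cong)
  qed
  moreover have "prob_dist {S'. card S' = K} (\<lambda>S'. of_bool (S' = S))"
    using S(2) by (simp add: prob_dist_def of_bool_def)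
  moreover have "stochastic_map X (messages S') (\<lambda>m x. of_bool (m = msg S' x))" for X S'
    using msg[of S'] by (simp add: stochastic_map_def prob_dist_def of_bool_def messages_def)
  moreover have "stochastic_map (messages UNIV) UNIV (\<lambda>b' m. of_bool (b' = dec m))"
    by (simp add: stochastic_map_def prob_dist_def of_bool_def)
  ultimately show ?thesis
    unfolding local_macs_def using pm
    by (intro CollectI conjI exI[of _ "\<lambda>S'. of_bool (S' = S)"]
        exI[of _ "\<lambda>S' m x. of_bool (m = msg S' x)"] exI[of _ "\<lambda>b' m. of_bool (b' = dec m)"]) auto
qed

section \<open>Linear independence by triangularity\<close>

lemma inj_on_independent_triangular:
  fixes v :: "'j \<Rightarrow> real ^ 'm" and r :: "'j \<Rightarrow> nat"
  assumes J: "finite J"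
    and diag: "\<And>j. j \<in> J \<Longrightarrow> v j $ c j \<noteq> 0"
    and tri: "\<And>j j'. \<lbrakk>j \<in> J; j' \<in> J; j' \<noteq> j; r j \<le> r j'\<rbrakk> \<Longrightarrow> v j' $ c j = 0"
  shows "inj_on v J" and "independent (v ` J)"
proof -
  show inj: "inj_on v J"
  proof (rule inj_onI, rule ccontr)
    fix j j' assume "j \<in> J" "j' \<in> J" "v j = v j'" "j \<noteq> j'"
    then show False using diag tri by (metis nat_le_linear)
  qed
  \<comment> \<open>Read the relation at coordinate \<open>c j\<close>: terms of smaller rank vanish
    by induction, and the other terms with index different from \<open>j\<close> vanish by
    \<open>tri\<close>.\<close>
  have zero: "u j = 0" if u: "(\<Sum>j\<in>J. u j *\<^sub>R v j) = 0" and "j \<in> J" for u j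
    using \<open>j \<in> J\<close>
  proof (induction "r j" arbitrary: j rule: less_induct)
    case less
    have "0 = (\<Sum>j'\<in>J. u j' * v j' $ c j)"
      using arg_cong[OF u, of "\<lambda>x. x $ c j"] by simp
    also have "\<dots> = (\<Sum>j'\<in>{j}. u j' * v j' $ c j)"
    proof (rule sum.mono_neutral_right)
      show "\<forall>j'\<in>J - {j}. u j' * v j' $ c j = 0"
        using less tri by (metis DiffE insertI1 leI mult_eq_0_iff)
    qed (use J less.prems in auto)
    finally show ?case using diag[OF less.prems] by simp
  qed
  show "independent (v ` J)"
  proof (rule independent_if_scalars_zero)
    fix f x assume f: "(\<Sum>x\<in>v ` J. f x *\<^sub>R x) = 0" and x: "x \<in> v ` J"
    have "(\<Sum>j\<in>J. f (v j) *\<^sub>R v j) = 0" using f inj by (simp add: sum.reindex)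
    from zero[OF this] x show "f x = 0" by auto
  qed (use J in simp)
qed

text \<open>Each vector is tested at the coordinate given by its own index pair, and the rank of an
  index is the size of its support.\<close>

lemma inj_on_independent_transfer_cylinder:
  fixes A :: "'n::finite \<Rightarrow> 'a::finite set" and b0 :: "'b::finite" and z :: "'n \<Rightarrow> 'a" and K :: nat
  defines "v \<equiv> \<lambda>(b, a). transfer b0 b (indicator (cylinder A (support z a) a))"
    and "J \<equiv> (UNIV - {b0}) \<times> {a \<in> \<Pi>\<^sub>E i\<in>UNIV. A i. card (support z a) \<le> K}"
  shows "inj_on v J" and "independent (v ` J)"
proof -
  have tri: "v j' $ j = 0"
    if "j \<in> J" "j' \<in> J" "j' \<noteq> j" "card (support z (snd j)) \<le> card (support z (snd j'))" for j j'
  proof -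
    obtain b a b' a' where j: "j = (b, a)" "j' = (b', a')" by fastforce
    \<comment> \<open>Agreement with \<open>a'\<close> on its support puts that support inside the
      support of \<open>a\<close>. The rank inequality makes the two equal, and off the common
      support both inputs are \<open>z\<close>.\<close>
    have "a' = a" if "a \<in> cylinder A (support z a') a'"
    proof -
      have agree: "\<forall>s\<in>support z a'. a s = a' s" using that by (simp add: cylinder_def)
      then have "support z a' \<subseteq> support z a" by (auto simp: support_def)
      then have "support z a' = support z a"
        using \<open>card (support z (snd j)) \<le> _\<close> j by (intro card_seteq) auto
      then show ?thesis using agree by (simp add: support_def set_eq_iff fun_eq_iff) metis
    qed
    \<comment> \<open>If \<open>a' = a\<close>, then \<open>b' \<noteq> b\<close>; as also
      \<open>b \<noteq> b0\<close>, the factor depending on the output is 0.\<close>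
    then show ?thesis
      using that by (auto simp: v_def J_def transfer_nth j indicator_def)
  qed
  have diag: "v j $ j \<noteq> 0" if "j \<in> J" for j
    using that by (auto simp: v_def J_def transfer_nth cylinder_def)
  have "finite J" by (simp add: J_def)
  note triangular = inj_on_independent_triangular[where c = "\<lambda>j. j"
      and r = "\<lambda>j. card (support z (snd j))", OF this]
  show "inj_on v J" by (rule triangular(1)) (fact diag tri)+
  show "independent (v ` J)" by (rule triangular(2)) (fact diag tri)+
qed

section \<open>Counting the index pairs\<close>

lemma card_bounded_support:
  fixes A :: "'n::finite \<Rightarrow> 'a::finite set"
  assumes z: "z \<in> (\<Pi>\<^sub>E i\<in>UNIV. A i)" and c: "\<And>i. card (A i) = c"
  shows "card {a \<in> \<Pi>\<^sub>E i\<in>UNIV. A i. card (support z a) \<le> K} =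
    (\<Sum>k=0..K. (c - 1) ^ k * (CARD('n) choose k))"
proof -
  let ?F = "\<lambda>T. {a \<in> \<Pi>\<^sub>E i\<in>UNIV. A i. support z a = T}"
  \<comment> \<open>Each sender in \<open>T\<close> has \<open>c - 1\<close> values to choose from,
    and every other sender is forced to its reference value.\<close>
  have F: "card (?F T) = (c - 1) ^ card T" for T
  proof -
    have "?F T = (\<Pi>\<^sub>E i\<in>UNIV. if i \<in> T then A i - {z i} else {z i})"
      using z by (auto simp: support_def PiE_iff split: if_splits) metis+
    moreover have "card (A i - {z i}) = c - 1" for i
      using z c by (simp add: PiE_iff)
    ultimately show ?thesis
      by (simp add: card_PiE if_distrib[of card] prod.If_cases cong: if_cong)
  qed
  have "{a \<in> \<Pi>\<^sub>E i\<in>UNIV. A i. card (support z a) \<le> K} =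
      (\<Union>k\<in>{0..K}. \<Union>T\<in>{T. card T = k}. ?F T)"
    by auto
  also have "card \<dots> = (\<Sum>k=0..K. card (\<Union>T\<in>{T. card T = k}. ?F T))"
    by (rule card_UN_disjoint) auto
  also have "\<dots> = (\<Sum>k=0..K. \<Sum>T | card T = k. card (?F T))"
    by (intro sum.cong refl card_UN_disjoint) auto
  also have "\<dots> = (\<Sum>k=0..K. (c - 1) ^ k * (CARD('n) choose k))"
    using n_subsets[of "UNIV :: 'n set"] by (simp add: F mult.commute)
  finally show ?thesis .
qed

theorem theorem3:
  fixes A :: "'n::finite \<Rightarrow> 'a::finite set" and K c :: nat
  assumes "1 \<le> K" and "K \<le> CARD('n)"
    and "\<And>i. A i \<noteq> {}" and "\<And>i. card (A i) = c"
  shows "aff_dim (local_macs K A :: (real ^ ('b::finite \<times> ('n \<Rightarrow> 'a))) set) =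
    (int CARD('b) - 1) * (\<Sum>k=0..K. (int c - 1) ^ k * int (CARD('n) choose k))"
proof -
  define z where "z = (\<lambda>i. SOME x. x \<in> A i)"
  have z: "z \<in> (\<Pi>\<^sub>E i\<in>UNIV. A i)" using assms(3) by (simp add: PiE_iff z_def some_in_eq)
  \<comment> \<open>This makes the truncated subtraction \<open>c - 1\<close> in the count agree
    with the integer subtraction in the claim.\<close>
  have c: "1 \<le> c" using assms(3,4) by (metis One_nat_def Suc_leI card_gt_0_iff finite)
  fix b0 :: 'b
  let ?L = "local_macs K A :: (real ^ ('b \<times> ('n \<Rightarrow> 'a))) set"
  let ?I = "{a \<in> \<Pi>\<^sub>E i\<in>UNIV. A i. card (support z a) \<le> K}"
  let ?J = "(UNIV - {b0}) \<times> ?I"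
  let ?v = "\<lambda>(b, a). transfer b0 b (indicator (cylinder A (support z a) a))"
  let ?p0 = "const_mac A b0"
  \<comment> \<open>Taking \<open>b = b0\<close> makes the transfer vector 0, so the base point
    itself is local.\<close>
  have "?p0 \<in> ?L"
    using const_mac_plus_transfer_in_local_macs[OF assms(1,2), of "{}" A b0 b0]
    by (simp add: transfer_self)
  then have "aff_dim ?L = int (dim ((+) (- ?p0) ` ?L))"
    by (intro aff_dim_eq_dim hull_inc)
  also have "dim ((+) (- ?p0) ` ?L) = card (?v ` ?J)"
  \<comment> \<open>The candidate vectors lie in the translated set and span it, so being
    independent they are a basis of its span.\<close>
  proof (rule dim_unique)
    show "?v ` ?J \<subseteq> (+) (- ?p0) ` ?L"
    proof
      fix x assume "x \<in> ?v ` ?J"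
      then have "?p0 + x \<in> ?L"
        by (auto intro!: const_mac_plus_transfer_in_local_macs[OF assms(1,2)])
      then show "x \<in> (+) (- ?p0) ` ?L" by (rule rev_image_eqI) simp
    qed
    show "(+) (- ?p0) ` ?L \<subseteq> span (?v ` ?J)"
      using local_mac_minus_const_mac_in_span[OF _ z, of _ K b0] by auto
    show "independent (?v ` ?J)" by (rule inj_on_independent_transfer_cylinder)
  qed simp
  also have "card (?v ` ?J) = (CARD('b) - 1) * (\<Sum>k=0..K. (c - 1) ^ k * (CARD('n) choose k))"
    using inj_on_independent_transfer_cylinder(1)[of b0 A z K]
    by (simp add: card_image card_cartesian_product card_bounded_support[OF z assms(4)])
  also have "int \<dots> = (int CARD('b) - 1) * (\<Sum>k=0..K. (int c - 1) ^ k * int (CARD('n) choose k))"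
    using c by (simp add: of_nat_diff Suc_leI)
  finally show ?thesis .
qed

end
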